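(* Let $\mathbb{k}$ be an algebraically closed field, $n\ge2$, $C,C'\in\mathcal M_{n-1}$, and $V=\mathbb{k}p_n$ the $1$-dimensional homogeneous vector space of degree $n$. Let $\gamma\in Z_g^2(\mathfrak p(C),V)$ and $\theta\in Z_g^2(\mathfrak p(C'),V)$. The central extensions $\mathfrak p(C)_\gamma$ and $\mathfrak p(C')_\theta$ are isomorphic as graded algebras if and only if there exists a graded algebra isomorphism $\sigma:\mathfrak p(C)\to\mathfrak p(C')$ such that $\theta_\sigma$ and $\gamma$ are colinear in $Z_g^2(\mathfrak p(C),V)$, in the sense that $\theta_\sigma=b\gamma$ for some $b\in\mathbb{k}\setminus\{0\}$. In particular, for nonzero $2$-cocycles $\theta,\gamma\in Z_g^2(\mathfrak p(C),V)$, one has $\mathfrak p(C)_\theta\cong\mathfrak p(C)_\gamma$ if and only if $[\theta]$ and $[\gamma]$ lie in the same $\mathrm{Aut}(\mathfrak p(C))$-orbit of the Grassmannian of $1$-dimensional subspaces of $Z_g^2(\mathfrak p(C),V)$, where $[\theta]=\mathrm{span}_{\mathbb{k}}\{\theta\}$.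
   Context: $[m]=\{1,\dots,m\}$. $\mathcal M_m$ is the set of $m\times m$ symmetric matrices $C=(c_{ij})_{i,j\in[m]}$ over $\mathbb{k}$ with $c_{ij}=0$ if $i+j>m$ and $c_{jk}c_{i,j+k}=c_{ij}c_{i+j,k}$ for all $i,j,k\ge 1$ (where $c_{ij}$ is read as $0$ whenever $i+j>m$). For $C\in\mathcal M_m$, the $m$-dimensional diagonally graded commutative algebra (DGCA) $\mathfrak p(C)$ is the $\mathbb N^+$-graded vector space with fixed basis $p_1,\dots,p_m$, $\deg p_i=i$, and multiplication $p_ip_j=c_{ij}p_{i+j}$ (where $p_l=0$ for $l>m$); it is a commutative associative graded algebra. Isomorphisms and automorphisms are degree-preserving linear bijections that are multiplicative; $\mathrm{Aut}(\mathfrak p(C))$ is the group of graded automorphisms. For $C\in\mathcal M_{n-1}$, $Z_g^2(\mathfrak p(C),V)$ is the space of graded $2$-cocycles: degree-preserving symmetric bilinear maps $\theta:\mathfrak p(C)\times\mathfrak p(C)\to V$ with $\theta(ab,c)=\theta(a,bc)$ for all $a,b,c$. The central extension $\mathfrak p(C)_\theta$ is $\mathfrak p(C)\oplus V$ with multiplication $(a+v)\cdot_\theta(b+w)=ab+\theta(a,b)$; it is an $n$-dimensional DGCA. For a graded algebra isomorphism $\sigma:\mathfrak p(C)\to\mathfrak p(C')$ and $\theta\in Z_g^2(\mathfrak p(C'),V)$, define $\theta_\sigma\in Z_g^2(\mathfrak p(C),V)$ by $\theta_\sigma(x,y)=\theta(\sigma(x),\sigma(y))$. For $C=C'$ this is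 a right action of $\mathrm{Aut}(\mathfrak p(C))$ on $Z_g^2(\mathfrak p(C),V)$, inducing the action $[\theta]\cdot\sigma=[\theta_\sigma]$ on $1$-dimensional subspaces. *)

theory Defs
  imports
    "HOL-Computational_Algebra.Polynomial"
    "HOL-Algebra.Group_Action"
    "HOL-Library.Function_Algebras"
    "HOL-Library.Product_Plus"
begin

text \<open>
  Graded vector spaces and graded algebras. Addition and zero come from the ambient type
  (pointwise for functions, componentwise for pairs); \<open>component A d\<close> is the homogeneous
  component of degree \<open>d\<close>, including \<open>0\<close>.
\<close>

record ('k, 'a) graded_space = "'a partial_object" +
  scale :: "'k \<Rightarrow> 'a \<Rightarrow> 'a"
  component :: "nat \<Rightarrow> 'a set"

record ('k, 'a) graded_algebra = "('k, 'a) graded_space" +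
  gmult :: "'a \<Rightarrow> 'a \<Rightarrow> 'a"

definition linear_on ::
  "('k, 'a::ab_group_add, 'c) graded_space_scheme \<Rightarrow>
   ('k, 'b::ab_group_add, 'd) graded_space_scheme \<Rightarrow> ('a \<Rightarrow> 'b) \<Rightarrow> bool" where
  "linear_on A B f \<longleftrightarrow>
     (\<forall>x\<in>carrier A. \<forall>y\<in>carrier A. f (x + y) = f x + f y) \<and>
     (\<forall>c. \<forall>x\<in>carrier A. f (scale A c x) = scale B c (f x))"

definition graded_iso ::
  "('k, 'a::ab_group_add) graded_algebra \<Rightarrow> ('k, 'b::ab_group_add) graded_algebra \<Rightarrow>
   ('a \<Rightarrow> 'b) set" where
  "graded_iso A B = {f.
     bij_betw f (carrier A) (carrier B) \<and>
     linear_on A B f \<and>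
     (\<forall>d. f ` component A d \<subseteq> component B d) \<and>
     (\<forall>x\<in>carrier A. \<forall>y\<in>carrier A. f (gmult A x y) = gmult B (f x) (f y))}"

definition graded_isomorphic ::
  "('k, 'a::ab_group_add) graded_algebra \<Rightarrow> ('k, 'b::ab_group_add) graded_algebra \<Rightarrow> bool" where
  "graded_isomorphic A B \<longleftrightarrow> graded_iso A B \<noteq> {}"

text \<open>As for \<open>AutoGroup\<close>, only maps that are extensional on the carrier are taken.\<close>

definition Aut :: "('k, 'a::ab_group_add) graded_algebra \<Rightarrow> ('a \<Rightarrow> 'a) monoid" where
  "Aut A = BijGroup (carrier A) \<lparr>carrier := graded_iso A A \<inter> Bij (carrier A)\<rparr>"


text \<open>
  The graded vector space with basis \<open>p\<^sub>i\<close>, \<open>i \<in> S\<close>, where \<open>deg p\<^sub>i = i\<close>: a vector is its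
  coordinate function, which vanishes off \<open>S\<close>.
\<close>

definition basis_vec :: "nat \<Rightarrow> nat \<Rightarrow> 'k::field" where
  "basis_vec i = (\<lambda>l. if l = i then 1 else 0)"

definition free_graded :: "nat set \<Rightarrow> ('k::field, nat \<Rightarrow> 'k) graded_space" where
  "free_graded S = \<lparr>
     carrier = {x. \<forall>i. i \<notin> S \<longrightarrow> x i = 0},
     scale = (\<lambda>c x i. c * x i),
     component = (\<lambda>d. {x. (\<forall>i. i \<notin> S \<longrightarrow> x i = 0) \<and> (\<forall>i. i \<noteq> d \<longrightarrow> x i = 0)})\<rparr>"

text \<open>
  An \<open>m \<times> m\<close> matrix is a function on index pairs that vanishes off \<open>{1..m} \<times> {1..m}\<close>, so that
  \<open>C i j\<close> is automatically read as \<open>0\<close> whenever an index exceeds \<open>m\<close>.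
\<close>

definition DGCA_matrices :: "nat \<Rightarrow> (nat \<Rightarrow> nat \<Rightarrow> 'k::field) set" where
  "DGCA_matrices m = {C.
     (\<forall>i j. \<not> (i \<in> {1..m} \<and> j \<in> {1..m}) \<longrightarrow> C i j = 0) \<and>
     (\<forall>i\<in>{1..m}. \<forall>j\<in>{1..m}. C i j = C j i) \<and>
     (\<forall>i\<in>{1..m}. \<forall>j\<in>{1..m}. i + j > m \<longrightarrow> C i j = 0) \<and>
     (\<forall>i\<ge>1. \<forall>j\<ge>1. \<forall>k\<ge>1. C j k * C i (j + k) = C i j * C (i + j) k)}"

text \<open>
  The multiplication is the bilinear extension of \<open>p\<^sub>i p\<^sub>j = C i j p\<^bsub>i+j\<^esub>\<close> with
  \<open>p\<^sub>l = 0\<close> for \<open>l > m\<close>, written by coordinates; see \<open>DGCA_mult_basis\<close>.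
\<close>

definition DGCA :: "nat \<Rightarrow> (nat \<Rightarrow> nat \<Rightarrow> 'k::field) \<Rightarrow> ('k, nat \<Rightarrow> 'k) graded_algebra" where
  "DGCA m C = graded_space.extend (free_graded {1..m})
     (graded_algebra.fields
       (\<lambda>x y l. if l \<le> m then \<Sum>i\<in>{1..<l}. C i (l - i) * x i * y (l - i) else 0))"

lemma DGCA_simps [simp]:
  "carrier (DGCA m C) = carrier (free_graded {1..m})"
  "scale (DGCA m C) = scale (free_graded {1..m})"
  "component (DGCA m C) = component (free_graded {1..m})"
  "gmult (DGCA m C) =
     (\<lambda>x y l. if l \<le> m then \<Sum>i\<in>{1..<l}. C i (l - i) * x i * y (l - i) else 0)"
  by (simp_all add: DGCA_def graded_space.defs graded_algebra.defs)

lemma DGCA_mult_basis: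
  assumes "i \<in> {1..m}" "j \<in> {1..m}"
  shows "gmult (DGCA m C) (basis_vec i) (basis_vec j) =
           (if i + j \<le> m then scale (DGCA m C) (C i j) (basis_vec (i + j)) else 0)"
proof
  fix l
  have "(\<Sum>a\<in>{1..<l}. C a (l - a) * basis_vec i a * basis_vec j (l - a)) =
        (\<Sum>a\<in>{1..<l}. if a = i then C a (l - a) * basis_vec j (l - a) else 0)"
    by (intro sum.cong) (auto simp: basis_vec_def)
  also have "\<dots> = (if l = i + j then C i j else 0)"
    using assms by (auto simp: basis_vec_def)
  finally show "gmult (DGCA m C) (basis_vec i) (basis_vec j) l =
      (if i + j \<le> m then scale (DGCA m C) (C i j) (basis_vec (i + j)) else 0) l"
    by (auto simp: free_graded_def basis_vec_def)
qed


text \<open>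
  Bilinear maps on \<open>A\<close> are represented by their extension by \<open>0\<close> off the carrier, so that equality
  of bilinear maps is equality of functions and the cocycles form a subspace of a function space.
\<close>

definition cocycles ::
  "('k, 'a::ab_group_add) graded_algebra \<Rightarrow> ('k, 'v::ab_group_add) graded_space \<Rightarrow>
   ('a \<Rightarrow> 'a \<Rightarrow> 'v) set" where
  "cocycles A V = {\<theta>.
     (\<forall>x y. \<not> (x \<in> carrier A \<and> y \<in> carrier A) \<longrightarrow> \<theta> x y = 0) \<and>
     (\<forall>x\<in>carrier A. \<forall>y\<in>carrier A. \<theta> x y \<in> carrier V) \<and>
     (\<forall>x\<in>carrier A. linear_on A V (\<lambda>y. \<theta> x y)) \<and>
     (\<forall>y\<in>carrier A. linear_on A V (\<lambda>x. \<theta> x y)) \<and>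
     (\<forall>x\<in>carrier A. \<forall>y\<in>carrier A. \<theta> x y = \<theta> y x) \<and>
     (\<forall>d e. \<forall>x\<in>component A d. \<forall>y\<in>component A e. \<theta> x y \<in> component V (d + e)) \<and>
     (\<forall>x\<in>carrier A. \<forall>y\<in>carrier A. \<forall>z\<in>carrier A.
        \<theta> (gmult A x y) z = \<theta> x (gmult A y z))}"

definition cocycle_scale ::
  "('k, 'v) graded_space \<Rightarrow> 'k \<Rightarrow> ('a \<Rightarrow> 'a \<Rightarrow> 'v) \<Rightarrow> 'a \<Rightarrow> 'a \<Rightarrow> 'v" where
  "cocycle_scale V c \<theta> = (\<lambda>x y. scale V c (\<theta> x y))"

definition pullback ::
  "('k, 'a) graded_algebra \<Rightarrow> ('a \<Rightarrow> 'b) \<Rightarrow> ('b \<Rightarrow> 'b \<Rightarrow> 'v::zero) \<Rightarrow> 'a \<Rightarrow> 'a \<Rightarrow> 'v" where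
  "pullback A \<sigma> \<theta> =
     (\<lambda>x y. if x \<in> carrier A \<and> y \<in> carrier A then \<theta> (\<sigma> x) (\<sigma> y) else 0)"

definition central_extension ::
  "('k, 'a) graded_algebra \<Rightarrow> ('k, 'v) graded_space \<Rightarrow> ('a \<Rightarrow> 'a \<Rightarrow> 'v) \<Rightarrow>
   ('k, 'a \<times> 'v) graded_algebra" where
  "central_extension A V \<theta> = \<lparr>
     carrier = carrier A \<times> carrier V,
     scale = (\<lambda>c (a, v). (scale A c a, scale V c v)),
     component = (\<lambda>d. component A d \<times> component V d),
     gmult = (\<lambda>(a, v) (b, w). (gmult A a b, \<theta> a b))\<rparr>"

text \<open>
  For \<open>V = free_graded S\<close>, the library notions \<open>module.span\<close>, \<open>module.subspace\<close> and
  \<open>vector_space.dim\<close> are applied to \<open>cocycle_scale V\<close>.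
\<close>

lemma vector_space_cocycle_scale: "vector_space (cocycle_scale (free_graded S))"
  by unfold_locales
    (auto simp: cocycle_scale_def free_graded_def fun_eq_iff algebra_simps)

lemma subspace_cocycles:
  "module.subspace (cocycle_scale (free_graded S)) (cocycles A (free_graded S))"
proof -
  interpret vector_space "cocycle_scale (free_graded S)"
    by (rule vector_space_cocycle_scale)
  have sum: "\<theta> + \<gamma> \<in> cocycles A (free_graded S)"
    if "\<theta> \<in> cocycles A (free_graded S)" "\<gamma> \<in> cocycles A (free_graded S)" for \<theta> \<gamma>
    using that unfolding cocycles_def linear_on_def mem_Collect_eq
    by (intro conjI ballI allI impI)
      (simp_all add: free_graded_def fun_eq_iff algebra_simps)
  have scaled: "cocycle_scale (free_graded S) c \<theta> \<in> cocycles A (free_graded S)"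
    if "\<theta> \<in> cocycles A (free_graded S)" for c \<theta>
    using that unfolding cocycles_def linear_on_def mem_Collect_eq
    by (intro conjI ballI allI impI)
      (simp_all add: cocycle_scale_def free_graded_def fun_eq_iff algebra_simps)
  have zero: "0 \<in> cocycles A (free_graded S)"
    unfolding cocycles_def linear_on_def by (simp add: free_graded_def fun_eq_iff)
  show ?thesis
    by (intro subspaceI sum scaled zero)
qed

definition grassmannian ::
  "nat \<Rightarrow> ('k::field, 'a::ab_group_add) graded_algebra \<Rightarrow>
   ('k, 'v::ab_group_add) graded_space \<Rightarrow> ('a \<Rightarrow> 'a \<Rightarrow> 'v) set set" where
  "grassmannian k A V = {W. W \<subseteq> cocycles A V \<and>
     module.subspace (cocycle_scale V) W \<and> vector_space.dim (cocycle_scale V) W = k}"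

lemma span_in_grassmannian:
  assumes "\<theta> \<in> cocycles A (free_graded S)" "\<theta> \<noteq> 0"
  shows "module.span (cocycle_scale (free_graded S)) {\<theta>}
           \<in> grassmannian 1 A (free_graded S)"
proof -
  interpret vector_space "cocycle_scale (free_graded S)"
    by (rule vector_space_cocycle_scale)
  have "span {\<theta>} \<subseteq> cocycles A (free_graded S)"
    using assms(1) by (intro span_minimal subspace_cocycles) auto
  moreover have "dim (span {\<theta>}) = 1"
    using assms(2) by (simp add: dim_span dim_eq_card_independent)
  ultimately show ?thesis
    by (simp add: grassmannian_def subspace_span)
qed

text \<open>
  The Aut-orbits for the right action \<open>W \<cdot> \<sigma> = {\<theta>\<^sub>\<sigma> | \<theta> \<in> W}\<close>, under which
  \<open>[\<theta>] \<cdot> \<sigma> = [\<theta>\<^sub>\<sigma>]\<close>. The library's \<open>orbits\<close> is usually applied to left actions,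
  but it does not refer to the order of multiplication in the group.
\<close>

definition grassmannian_orbits ::
  "nat \<Rightarrow> ('k::field, 'a::ab_group_add) graded_algebra \<Rightarrow>
   ('k, 'v::ab_group_add) graded_space \<Rightarrow> ('a \<Rightarrow> 'a \<Rightarrow> 'v) set set set" where
  "grassmannian_orbits k A V =
     orbits (Aut A) (grassmannian k A V) (\<lambda>\<sigma> W. pullback A \<sigma> ` W)"

end

theory Submission
  imports Defs
begin

text \<open>
  The base of the extension lives in degrees \<open>1, \<dots>, n - 1\<close> and the kernel \<open>V\<close> in degree \<open>n\<close>, so
  an isomorphism \<open>f\<close> of the extensions cannot mix the two: it is diagonal,
  \<open>f (x, v) = (\<sigma> x, b v)\<close>, where the second entry is a scalar because \<open>V\<close> is a line
  (\<open>graded_iso_central_extension_diagonal\<close>). Such a map is bijective iff \<open>\<sigma>\<close> is and \<open>b \<noteq> 0\<close>.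
  Since \<open>(x, v) (y, w) = (x y, \<gamma> x y)\<close>, it is multiplicative iff \<open>\<sigma>\<close> is and
  \<open>\<theta> (\<sigma> x) (\<sigma> y) = b (\<gamma> x y)\<close> (\<open>diagonal_graded_iso_iff\<close>). This is the first half of the
  theorem.

  For \<open>C = C'\<close> the second half rephrases the relation "\<open>\<gamma>\<^sub>\<sigma>\<close> is a nonzero multiple of \<open>\<theta>\<close> for some
  \<open>\<sigma>\<close>". As pulling back is linear, it says that \<open>\<sigma>\<close> carries the line of \<open>\<gamma>\<close> to the line of \<open>\<theta>\<close>
  (\<open>same_orbit_if_pullback_colinear\<close>). Conversely, an orbit is given as
  the set of images of some line \<open>W\<close>; if \<open>g\<close> and \<open>h\<close> produce the lines of \<open>\<theta>\<close> and \<open>\<gamma>\<close> from \<open>W\<close>, then \<open>\<sigma> = h\<inverse> \<circ> g\<close> works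
  (\<open>pullback_colinear_if_same_orbit\<close>). This uses that \<open>h\<inverse>\<close> is again a graded
  isomorphism, although a graded map is only required to send components into components:
  the components have dimension at most one, so an injective graded map between algebras with
  the same range of degrees fills them.
\<close>

section \<open>Graded spaces with one-dimensional components\<close>

lemma free_graded_simps:
  "x \<in> carrier (free_graded S) \<longleftrightarrow> (\<forall>i. i \<notin> S \<longrightarrow> x i = 0)"
  "scale (free_graded S) c x = (\<lambda>i. c * x i)"
  "x \<in> component (free_graded S) d \<longleftrightarrow>
     (\<forall>i. i \<notin> S \<longrightarrow> x i = 0) \<and> (\<forall>i. i \<noteq> d \<longrightarrow> x i = 0)"
  by (simp_all add: free_graded_def)

lemma component_eq_0:
  assumes "x \<in> component (free_graded S) d" "d \<notin> S"
  shows "x = 0"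
proof
  fix i
  show "x i = 0 i"
    using assms by (cases "i = d") (auto simp: free_graded_simps)
qed

lemma component_eq_scale_basis_vec:
  assumes "x \<in> component (free_graded S) d"
  shows "x = scale (free_graded S) (x d) (basis_vec d)"
  using assms by (auto simp: free_graded_simps basis_vec_def fun_eq_iff)

lemma basis_vec_in_component: "d \<in> S \<Longrightarrow> basis_vec d \<in> component (free_graded S) d"
  by (auto simp: free_graded_simps basis_vec_def)

text \<open>
  With finitely many degrees, a vector is the sum of its homogeneous parts; the proof splits
  them off one degree at a time.
\<close>

lemma free_graded_induct [consumes 2, case_names zero add homogeneous]:
  assumes "finite S" "x \<in> carrier (free_graded S)"
    and zero: "P 0"
    and add: "\<And>a b. a \<in> carrier (free_graded S) \<Longrightarrow> b \<in> carrier (free_graded S) \<Longrightarrow>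
      P a \<Longrightarrow> P b \<Longrightarrow> P (a + b)"
    and homogeneous: "\<And>d a. d \<in> S \<Longrightarrow> a \<in> component (free_graded S) d \<Longrightarrow> P a"
  shows "P x"
proof -
  have "P x" if "\<forall>i. i \<notin> T \<longrightarrow> x i = 0" "T \<subseteq> S" for T x
    using finite_subset[OF that(2) assms(1)] that
  proof (induction T arbitrary: x rule: finite_induct)
    case empty
    then have "x = 0"
      by (simp add: fun_eq_iff)
    then show ?case
      using zero by (simp only:)
  next
    case (insert d T)
    let ?a = "x(d := 0)" and ?b = "\<lambda>i. if i = d then x d else 0"
    have "P ?a"
      using insert.prems by (intro insert.IH) auto
    moreover have "P ?b"
      using insert.prems by (intro homogeneous[of d]) (auto simp: free_graded_simps)
    moreover have "?a \<in> carrier (free_graded S)" "?b \<in> carrier (free_graded S)"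
      using insert.prems by (auto simp: free_graded_simps)
    ultimately have "P (?a + ?b)"
      by (intro add)
    also have "?a + ?b = x"
      by (auto simp: fun_eq_iff)
    finally show ?case .
  qed
  from this[of S x] show ?thesis
    using assms(2) by (simp add: free_graded_simps)
qed


section \<open>Graded isomorphisms\<close>

lemma graded_isoD:
  assumes "f \<in> graded_iso A B"
  shows "bij_betw f (carrier A) (carrier B)"
    and "x \<in> carrier A \<Longrightarrow> f x \<in> carrier B"
    and "x \<in> carrier A \<Longrightarrow> y \<in> carrier A \<Longrightarrow> f (x + y) = f x + f y"
    and "x \<in> carrier A \<Longrightarrow> f (scale A c x) = scale B c (f x)"
    and "x \<in> component A d \<Longrightarrow> f x \<in> component B d"
    and "x \<in> carrier A \<Longrightarrow> y \<in> carrier A \<Longrightarrow> f (gmult A x y) = gmult B (f x) (f y)"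
  using assms by (auto simp: graded_iso_def linear_on_def image_subset_iff dest: bij_betwE)

lemma graded_iso_zero:
  assumes "f \<in> graded_iso A B" "0 \<in> carrier A"
  shows "f 0 = 0"
  using graded_isoD(3)[OF assms(1) assms(2) assms(2)] by simp

text \<open>
  The record type of graded algebras does not enforce closure of the carrier; restricting or
  inverting an isomorphism relies on it.
\<close>

definition closed_algebra :: "('k, 'a::ab_group_add) graded_algebra \<Rightarrow> bool" where
  "closed_algebra A \<longleftrightarrow>
     (\<forall>x\<in>carrier A. \<forall>y\<in>carrier A. x + y \<in> carrier A) \<and>
     (\<forall>c. \<forall>x\<in>carrier A. scale A c x \<in> carrier A) \<and>
     (\<forall>x\<in>carrier A. \<forall>y\<in>carrier A. gmult A x y \<in> carrier A) \<and>
     (\<forall>d. component A d \<subseteq> carrier A)"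

lemma graded_iso_cong:
  assumes f: "f \<in> graded_iso A B" and eq: "\<And>x. x \<in> carrier A \<Longrightarrow> f x = g x"
    and A: "closed_algebra A"
  shows "g \<in> graded_iso A B"
proof -
  have "bij_betw g (carrier A) (carrier B)"
    using graded_isoD(1)[OF f] bij_betw_cong[of "carrier A" f g "carrier B"] eq by blast
  moreover have "g (x + y) = g x + g y" if "x \<in> carrier A" "y \<in> carrier A" for x y
    using graded_isoD(3)[OF f that] eq A that by (metis closed_algebra_def)
  moreover have "g (scale A c x) = scale B c (g x)" if "x \<in> carrier A" for c x
    using graded_isoD(4)[OF f that] eq A that by (metis closed_algebra_def)
  moreover have "g x \<in> component B d" if "x \<in> component A d" for d x
    using graded_isoD(5)[OF f that] eq A that by (metis closed_algebra_def subsetD)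
  moreover have "g (gmult A x y) = gmult B (g x) (g y)"
    if "x \<in> carrier A" "y \<in> carrier A" for x y
    using graded_isoD(6)[OF f that] eq A that by (metis closed_algebra_def)
  ultimately show ?thesis
    by (auto simp: graded_iso_def linear_on_def)
qed

lemma graded_iso_inv_into:
  assumes f: "f \<in> graded_iso A B" and A: "closed_algebra A"
    and comp: "\<And>d. component B d \<subseteq> f ` component A d"
  shows "inv_into (carrier A) f \<in> graded_iso B A"
proof -
  let ?g = "inv_into (carrier A) f"
  have bij: "bij_betw f (carrier A) (carrier B)"
    using f by (rule graded_isoD)
  have g_f: "?g (f x) = x" if "x \<in> carrier A" for x
    using bij that by (rule bij_betw_inv_into_left)
  have f_g: "f (?g y) = y" and g: "?g y \<in> carrier A" if "y \<in> carrier B" for y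
    using bij_betw_inv_into_right[OF bij that] bij_betwE[OF bij_betw_inv_into[OF bij]] that by auto
  \<comment> \<open>An element of \<open>A\<close> is \<open>?g y\<close> as soon as \<open>f\<close> maps it to \<open>y\<close>.\<close>
  have "?g (y + z) = ?g y + ?g z" if "y \<in> carrier B" "z \<in> carrier B" for y z
  proof -
    have "f (?g y + ?g z) = y + z"
      using graded_isoD(3)[OF f] f_g g that by simp
    then show ?thesis
      using g_f[of "?g y + ?g z"] A g that by (simp add: closed_algebra_def)
  qed
  moreover have "?g (scale B c y) = scale A c (?g y)" if "y \<in> carrier B" for c y
  proof -
    have "f (scale A c (?g y)) = scale B c y"
      using graded_isoD(4)[OF f] f_g g that by simp
    then show ?thesis
      using g_f[of "scale A c (?g y)"] A g that by (simp add: closed_algebra_def)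
  qed
  moreover have "?g y \<in> component A d" if "y \<in> component B d" for d y
    using comp[of d] that g_f A unfolding closed_algebra_def by (smt (verit) imageE subsetD)
  moreover have "?g (gmult B y z) = gmult A (?g y) (?g z)"
    if "y \<in> carrier B" "z \<in> carrier B" for y z
  proof -
    have "f (gmult A (?g y) (?g z)) = gmult B y z"
      using graded_isoD(6)[OF f] f_g g that by simp
    then show ?thesis
      using g_f[of "gmult A (?g y) (?g z)"] A g that by (simp add: closed_algebra_def)
  qed
  ultimately show ?thesis
    using bij_betw_inv_into[OF bij] unfolding graded_iso_def linear_on_def by blast
qed

lemma graded_iso_comp:
  assumes f: "f \<in> graded_iso A B" and g: "g \<in> graded_iso B D"
  shows "g \<circ> f \<in> graded_iso A D"
proof -
  have "bij_betw (g \<circ> f) (carrier A) (carrier D)"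
    using graded_isoD(1)[OF f] graded_isoD(1)[OF g] by (rule bij_betw_trans)
  then show ?thesis
    using graded_isoD(2-6)[OF f] graded_isoD(3-6)[OF g]
    by (auto simp: graded_iso_def linear_on_def)
qed

lemma closed_DGCA: "closed_algebra (DGCA m C)"
  by (auto simp: closed_algebra_def free_graded_simps)

lemma DGCA_zero: "0 \<in> carrier (DGCA m C)"
  by (simp add: free_graded_simps)

text \<open>
  In a degree \<open>d\<close> between \<open>1\<close> and \<open>m\<close>, an injective graded map sends the basis vector
  \<open>p\<^sub>d\<close> to a nonzero vector of a component of dimension one, hence fills that component.
\<close>

lemma graded_iso_component_surj:
  assumes f: "f \<in> graded_iso (DGCA m C) (DGCA m C')"
    and y: "y \<in> component (DGCA m C') d"
  shows "y \<in> f ` component (DGCA m C) d"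
proof (cases "d \<in> {1..m}")
  case True
  let ?p = "basis_vec d :: nat \<Rightarrow> 'a"
  have p: "?p \<in> component (DGCA m C) d"
    using True by (simp add: basis_vec_in_component)
  then have p_carrier: "?p \<in> carrier (DGCA m C)"
    using closed_DGCA unfolding closed_algebra_def by blast
  have fp: "f ?p \<in> component (DGCA m C') d"
    using f p by (rule graded_isoD)
  have "f ?p d \<noteq> 0"
  proof
    assume "f ?p d = 0"
    then have "f ?p i = 0" for i
      using fp by (cases "i = d") (simp_all add: free_graded_simps)
    then have "f ?p = f 0"
      unfolding graded_iso_zero[OF f DGCA_zero] by (intro ext) simp
    then have "?p = 0"
      by (rule inj_onD[OF bij_betw_imp_inj_on[OF graded_isoD(1)[OF f]] _ p_carrier DGCA_zero])
    then have "?p d = 0"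
      by (simp only: zero_fun_apply)
    then show False
      by (simp add: basis_vec_def)
  qed
  have "y i = scale (DGCA m C') (y d / f ?p d) (f ?p) i" for i
    using y fp \<open>f ?p d \<noteq> 0\<close> by (cases "i = d") (simp_all add: free_graded_simps)
  then have "y = f (scale (DGCA m C) (y d / f ?p d) ?p)"
    unfolding graded_isoD(4)[OF f p_carrier] by (rule ext)
  moreover have "scale (DGCA m C) (y d / f ?p d) ?p \<in> component (DGCA m C) d"
    using p by (simp add: free_graded_simps)
  ultimately show ?thesis
    by blast
next
  case False
  have "y = 0"
    by (rule component_eq_0[of _ "{1..m}" d]) (use y False in simp_all)
  then show ?thesis
    using graded_iso_zero[OF f DGCA_zero]
    by (intro image_eqI[of _ _ 0]) (simp_all add: free_graded_simps)
qed

lemma restrict_in_Aut: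
  assumes "\<sigma> \<in> graded_iso (DGCA m C) (DGCA m C)"
  shows "restrict \<sigma> (carrier (DGCA m C)) \<in> carrier (Aut (DGCA m C))"
proof -
  let ?A = "DGCA m C"
  have "restrict \<sigma> (carrier ?A) \<in> graded_iso ?A ?A"
    using assms by (rule graded_iso_cong) (simp_all only: restrict_apply' closed_DGCA)
  moreover from this have "restrict \<sigma> (carrier ?A) \<in> Bij (carrier ?A)"
    unfolding Bij_def using graded_isoD(1) restrict_extensional by blast
  ultimately show ?thesis
    by (simp add: Aut_def)
qed


section \<open>Isomorphisms of central extensions\<close>

lemma central_extension_simps:
  "carrier (central_extension A V \<theta>) = carrier A \<times> carrier V"
  "scale (central_extension A V \<theta>) c (a, v) = (scale A c a, scale V c v)"
  "component (central_extension A V \<theta>) d = component A d \<times> component V d"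
  "gmult (central_extension A V \<theta>) (a, v) (b, w) = (gmult A a b, \<theta> a b)"
  by (simp_all add: central_extension_def)

lemma closed_central_extension:
  assumes "closed_algebra A" "\<theta> \<in> cocycles A (free_graded S)"
  shows "closed_algebra (central_extension A (free_graded S) \<theta>)"
proof -
  let ?V = "free_graded S"
  have A: "x + y \<in> carrier A" "scale A c x \<in> carrier A" "gmult A x y \<in> carrier A"
    if "x \<in> carrier A" "y \<in> carrier A" for x y c
    using assms(1) that by (auto simp: closed_algebra_def)
  have A_comp: "x \<in> carrier A" if "x \<in> component A d" for x d
    using assms(1) that by (auto simp: closed_algebra_def)
  have V: "v + w \<in> carrier ?V" "scale ?V c v \<in> carrier ?V"
    if "v \<in> carrier ?V" "w \<in> carrier ?V" for v w :: "nat \<Rightarrow> 'b" and c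
    using that by (auto simp: free_graded_simps)
  have V_comp: "v \<in> carrier ?V" if "v \<in> component ?V d" for v :: "nat \<Rightarrow> 'b" and d
    using that by (simp add: free_graded_simps)
  have "\<theta> x y \<in> carrier ?V" if "x \<in> carrier A" "y \<in> carrier A" for x y
    using assms(2) that unfolding cocycles_def by blast
  then show ?thesis
    unfolding closed_algebra_def
    by (auto simp: central_extension_simps intro: A A_comp V V_comp)
qed

text \<open>
  The components of the base live in degrees at most \<open>m\<close> and the one of the kernel in degree
  \<open>n > m\<close>, so a graded map cannot mix them. On the kernel, a line, a linear map is a multiplication
  by a scalar \<open>b\<close>, read off at the basis vector \<open>p\<^sub>n\<close>.
\<close>

lemma graded_iso_central_extension_diagonal:
  assumes f: "f \<in> graded_iso (central_extension (DGCA m C) (free_graded {n}) \<gamma>)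
                            (central_extension (DGCA m C') (free_graded {n}) \<theta>)"
    and "m < n"
  shows "\<exists>\<sigma> b. \<forall>x \<in> carrier (DGCA m C). \<forall>v \<in> carrier (free_graded {n}).
           f (x, v) = (\<sigma> x, scale (free_graded {n}) b v)"
proof -
  let ?A = "DGCA m C" and ?V = "free_graded {n} :: ('a, nat \<Rightarrow> 'a) graded_space"
  note E = central_extension_simps
  have zero: "f (0, 0) = (0, 0)"
    using graded_iso_zero[OF f] by (simp add: E zero_prod_def free_graded_simps)
  have base: "snd (f (x, 0)) = 0" if "x \<in> carrier ?A" for x
  proof -
    have "finite {1..m}" "x \<in> carrier (free_graded {1..m})"
      using that by simp_all
    then show ?thesis
    proof (induction rule: free_graded_induct)
      case zero
      then show ?case
        using \<open>f (0, 0) = (0, 0)\<close> by (simp only: snd_conv)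
    next
      case (add a b)
      have "f (a + b, 0) = f (a, 0) + f (b, 0)"
        using graded_isoD(3)[OF f, of "(a, 0)" "(b, 0)"] add(1,2)
        by (simp add: E free_graded_simps)
      then show ?case
        using add(3,4) by (simp only: snd_add add_0)
    next
      case (homogeneous d a)
      then have "f (a, 0) \<in> component (central_extension (DGCA m C') ?V \<theta>) d"
        by (intro graded_isoD(5)[OF f]) (auto simp: E free_graded_simps)
      then have "snd (f (a, 0)) \<in> component ?V d"
        by (auto simp: E)
      then show ?case
        by (rule component_eq_0) (use homogeneous(1) \<open>m < n\<close> in auto)
    qed
  qed
  let ?p = "basis_vec n"
  define b where "b = snd (f (0, ?p)) n"
  have p: "?p \<in> component ?V n" "?p \<in> carrier ?V"
    by (auto simp: free_graded_simps basis_vec_def)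
  then have "f (0, ?p) \<in> component (central_extension (DGCA m C') ?V \<theta>) n"
    by (intro graded_isoD(5)[OF f]) (auto simp: E free_graded_simps)
  then have "fst (f (0, ?p)) \<in> component (DGCA m C') n" "snd (f (0, ?p)) \<in> component ?V n"
    by (auto simp: E)
  then have fp: "f (0, ?p) = (0, scale ?V b ?p)"
    using component_eq_0[of "fst (f (0, ?p))" "{1..m}" n]
      component_eq_scale_basis_vec[of "snd (f (0, ?p))" "{n}" n] \<open>m < n\<close>
    by (simp add: b_def prod_eq_iff)
  have kernel: "f (0, v) = (0, scale ?V b v)" if "v \<in> carrier ?V" for v
  proof -
    have v: "v = scale ?V (v n) ?p"
      using that by (intro component_eq_scale_basis_vec) (auto simp: free_graded_simps)
    have "f (0, scale ?V (v n) ?p) = (0, scale ?V (v n) (scale ?V b ?p))"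
      using graded_isoD(4)[OF f, of "(0, ?p)" "v n"] p(2) fp
      by (simp add: E free_graded_simps zero_fun_def)
    also have "scale ?V (v n) (scale ?V b ?p) = scale ?V b (scale ?V (v n) ?p)"
      by (simp add: free_graded_simps mult.left_commute)
    finally show ?thesis
      unfolding v[symmetric] .
  qed
  have "f (x, v) = (fst (f (x, 0)), scale ?V b v)" if "x \<in> carrier ?A" "v \<in> carrier ?V" for x v
    using graded_isoD(3)[OF f, of "(x, 0)" "(0, v)"] base[OF that(1)] kernel[OF that(2)] that
    by (simp add: E free_graded_simps prod_eq_iff)
  then show ?thesis
    by (intro exI[of _ "\<lambda>x. fst (f (x, 0))"] exI[of _ b] ballI)
qed

lemma map_prod_image_Times: "map_prod f g ` (A \<times> B) = f ` A \<times> g ` B"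
  by force

lemma bij_betw_map_prod_iff:
  assumes "a \<in> A" "b \<in> B"
  shows "bij_betw (map_prod f g) (A \<times> B) (A' \<times> B') \<longleftrightarrow> bij_betw f A A' \<and> bij_betw g B B'"
proof -
  have "inj_on (map_prod f g) (A \<times> B) \<longleftrightarrow> inj_on f A \<and> inj_on g B"
    using assms by (fastforce simp: inj_on_def)
  moreover have "f ` A \<times> g ` B = A' \<times> B' \<longleftrightarrow> f ` A = A' \<and> g ` B = B'"
    using assms by (auto simp: times_eq_iff)
  ultimately show ?thesis
    by (auto simp: bij_betw_def map_prod_image_Times)
qed

lemma bij_betw_scale_line:
  "bij_betw (scale (free_graded {n}) b) (carrier (free_graded {n})) (carrier (free_graded {n}))
     \<longleftrightarrow> b \<noteq> (0 :: 'k::field)"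
proof
  let ?V = "free_graded {n} :: ('k, nat \<Rightarrow> 'k) graded_space"
  assume "bij_betw (scale ?V b) (carrier ?V) (carrier ?V)"
  moreover have "basis_vec n \<in> carrier ?V"
    by (simp add: free_graded_simps basis_vec_def)
  ultimately obtain v where "basis_vec n = scale ?V b v"
    by (metis bij_betw_imp_surj_on imageE)
  then have "basis_vec n n = b * v n"
    by (simp add: free_graded_simps)
  then show "b \<noteq> 0"
    by (auto simp: basis_vec_def)
next
  assume "b \<noteq> 0"
  then show "bij_betw (scale (free_graded {n}) b)
      (carrier (free_graded {n})) (carrier (free_graded {n}))"
    by (intro bij_betwI[where g = "scale (free_graded {n}) (1 / b)"])
      (auto simp: free_graded_simps)
qed

text \<open>
  The base coordinate of each clause of the definition of an isomorphism speaks of \<open>\<sigma>\<close> alone; the kernel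
  coordinate contributes only bijectivity of multiplication by \<open>b\<close> and, from the product
  \<open>(x, v) (y, w) = (x y, \<gamma> x y)\<close>, the comparison of the two cocycles.
\<close>

lemma diagonal_graded_iso_iff:
  assumes "\<gamma> \<in> cocycles (DGCA m C) (free_graded {n})"
  shows "map_prod \<sigma> (scale (free_graded {n}) b)
           \<in> graded_iso (central_extension (DGCA m C) (free_graded {n}) \<gamma>)
                        (central_extension (DGCA m C') (free_graded {n}) \<theta>) \<longleftrightarrow>
         \<sigma> \<in> graded_iso (DGCA m C) (DGCA m C') \<and> b \<noteq> 0 \<and>
         pullback (DGCA m C) \<sigma> \<theta> = cocycle_scale (free_graded {n}) b \<gamma>"
    (is "?f \<in> graded_iso ?E ?E' \<longleftrightarrow> _")
proof -
  let ?A = "DGCA m C" and ?B = "DGCA m C'"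
  let ?V = "free_graded {n} :: ('a, nat \<Rightarrow> 'a) graded_space"
  note E = central_extension_simps
  have zero: "0 \<in> carrier ?A" "0 \<in> carrier ?V" "\<And>d. 0 \<in> component ?V d"
    by (auto simp: free_graded_simps)
  have bij: "bij_betw ?f (carrier ?E) (carrier ?E') \<longleftrightarrow>
      bij_betw \<sigma> (carrier ?A) (carrier ?B) \<and> b \<noteq> 0"
    using zero(1,2) bij_betw_map_prod_iff bij_betw_scale_line by (metis E(1))
  have linear: "linear_on ?E ?E' ?f \<longleftrightarrow> linear_on ?A ?B \<sigma>"
    using zero(2)
    by (auto simp: linear_on_def E free_graded_simps(2) distrib_left fun_eq_iff mult.left_commute
        plus_prod_def intro!: ext)
  have graded: "(\<forall>d. ?f ` component ?E d \<subseteq> component ?E' d) \<longleftrightarrow>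
      (\<forall>d. \<sigma> ` component ?A d \<subseteq> component ?B d)"
  proof -
    have "scale ?V b v \<in> component ?V d" if "v \<in> component ?V d" for v d
      using that by (simp add: free_graded_simps)
    then have "?f ` component ?E d \<subseteq> component ?E' d \<longleftrightarrow> \<sigma> ` component ?A d \<subseteq> component ?B d" for d
      using zero(3)[of d] unfolding E map_prod_image_Times times_subset_iff by blast
    then show ?thesis
      by blast
  qed
  have pullback: "pullback ?A \<sigma> \<theta> = cocycle_scale ?V b \<gamma> \<longleftrightarrow>
      (\<forall>x\<in>carrier ?A. \<forall>y\<in>carrier ?A. scale ?V b (\<gamma> x y) = \<theta> (\<sigma> x) (\<sigma> y))"
  proof -
    \<comment> \<open>Off the carrier both sides vanish.\<close>
    have "scale ?V b (\<gamma> x y) = 0" if "\<not> (x \<in> carrier ?A \<and> y \<in> carrier ?A)" for x y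
    proof -
      have "\<gamma> x y = 0"
        using assms that unfolding cocycles_def by blast
      then show ?thesis
        by (simp add: free_graded_simps fun_eq_iff)
    qed
    then have "pullback ?A \<sigma> \<theta> x y = cocycle_scale ?V b \<gamma> x y \<longleftrightarrow>
        (x \<in> carrier ?A \<longrightarrow> y \<in> carrier ?A \<longrightarrow> scale ?V b (\<gamma> x y) = \<theta> (\<sigma> x) (\<sigma> y))" for x y
      unfolding pullback_def cocycle_scale_def by (simp only: split: if_split) metis
    then show ?thesis
      unfolding fun_eq_iff[where f = "pullback ?A \<sigma> \<theta>"]
        fun_eq_iff[where f = "pullback ?A \<sigma> \<theta> x" for x] by blast
  qed
  have "(\<forall>x\<in>carrier ?E. \<forall>y\<in>carrier ?E. ?f (gmult ?E x y) = gmult ?E' (?f x) (?f y)) \<longleftrightarrow>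
      (\<forall>x\<in>carrier ?A. \<forall>y\<in>carrier ?A. \<sigma> (gmult ?A x y) = gmult ?B (\<sigma> x) (\<sigma> y)) \<and>
      pullback ?A \<sigma> \<theta> = cocycle_scale ?V b \<gamma>"
    unfolding pullback using zero(2)
    by (auto simp: E simp del: DGCA_simps)
  then show ?thesis
    unfolding graded_iso_def mem_Collect_eq bij linear graded by blast
qed

lemma graded_isomorphic_central_extension_iff:
  assumes \<gamma>: "\<gamma> \<in> cocycles (DGCA m C) (free_graded {n})" and "m < n"
  shows "graded_isomorphic (central_extension (DGCA m C) (free_graded {n}) \<gamma>)
           (central_extension (DGCA m C') (free_graded {n}) \<theta>) \<longleftrightarrow>
         (\<exists>\<sigma> \<in> graded_iso (DGCA m C) (DGCA m C').
           \<exists>b. b \<noteq> 0 \<and> pullback (DGCA m C) \<sigma> \<theta> = cocycle_scale (free_graded {n}) b \<gamma>)"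
    (is "graded_isomorphic ?E ?E' \<longleftrightarrow> _")
proof
  let ?V = "free_graded {n} :: ('a, nat \<Rightarrow> 'a) graded_space"
  assume "graded_isomorphic ?E ?E'"
  then obtain f where f: "f \<in> graded_iso ?E ?E'"
    by (auto simp: graded_isomorphic_def)
  then obtain \<sigma> b where diag: "\<forall>x \<in> carrier (DGCA m C). \<forall>v \<in> carrier ?V.
      f (x, v) = (\<sigma> x, scale ?V b v)"
    using graded_iso_central_extension_diagonal \<open>m < n\<close> by blast
  have "map_prod \<sigma> (scale ?V b) \<in> graded_iso ?E ?E'"
    using f
  proof (rule graded_iso_cong)
    show "f x = map_prod \<sigma> (scale ?V b) x" if "x \<in> carrier ?E" for x
      using that diag by (auto simp: central_extension_simps)
    show "closed_algebra ?E"
      using closed_DGCA \<gamma> by (rule closed_central_extension)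
  qed
  then show "\<exists>\<sigma> \<in> graded_iso (DGCA m C) (DGCA m C').
      \<exists>b. b \<noteq> 0 \<and> pullback (DGCA m C) \<sigma> \<theta> = cocycle_scale ?V b \<gamma>"
    using diagonal_graded_iso_iff[OF \<gamma>] by blast
next
  assume "\<exists>\<sigma> \<in> graded_iso (DGCA m C) (DGCA m C').
    \<exists>b. b \<noteq> 0 \<and> pullback (DGCA m C) \<sigma> \<theta> = cocycle_scale (free_graded {n}) b \<gamma>"
  then show "graded_isomorphic ?E ?E'"
    using diagonal_graded_iso_iff[OF \<gamma>] unfolding graded_isomorphic_def by blast
qed


section \<open>Orbits of lines of cocycles\<close>

lemma pullback_cong:
  "(\<And>x. x \<in> carrier A \<Longrightarrow> \<sigma> x = \<tau> x) \<Longrightarrow> pullback A \<sigma> \<theta> = pullback A \<tau> \<theta>"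
  by (auto simp: pullback_def fun_eq_iff)

lemma pullback_pullback:
  assumes "\<And>x. x \<in> carrier A \<Longrightarrow> \<sigma> x \<in> carrier B"
  shows "pullback A \<sigma> (pullback B \<tau> \<theta>) = pullback A (\<tau> \<circ> \<sigma>) \<theta>"
  using assms by (auto simp: pullback_def fun_eq_iff)

lemma pullback_ident:
  assumes "\<theta> \<in> cocycles A V" "\<And>x. x \<in> carrier A \<Longrightarrow> \<sigma> x = x"
  shows "pullback A \<sigma> \<theta> = \<theta>"
  using assms by (auto simp: pullback_def cocycles_def fun_eq_iff)

lemma pullback_cocycle_scale:
  "pullback A \<sigma> (cocycle_scale (free_graded S) c \<theta>) =
     cocycle_scale (free_graded S) c (pullback A \<sigma> \<theta>)"
  by (auto simp: pullback_def cocycle_scale_def free_graded_simps fun_eq_iff)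

lemma span_cocycle:
  "module.span (cocycle_scale (free_graded S)) {\<theta>} =
     range (\<lambda>c. cocycle_scale (free_graded S) c \<theta>)"
proof -
  interpret vector_space "cocycle_scale (free_graded S)"
    by (rule vector_space_cocycle_scale)
  show ?thesis
    by (rule span_singleton)
qed

lemma pullback_image_span:
  "pullback A \<sigma> ` module.span (cocycle_scale (free_graded S)) {\<theta>} =
     module.span (cocycle_scale (free_graded S)) {pullback A \<sigma> \<theta>}"
  by (simp add: span_cocycle image_image pullback_cocycle_scale)

lemma span_cocycle_scale:
  assumes "c \<noteq> 0"
  shows "module.span (cocycle_scale (free_graded S)) {cocycle_scale (free_graded S) c \<theta>} =
    module.span (cocycle_scale (free_graded S)) {\<theta>}"
proof -
  interpret vector_space "cocycle_scale (free_graded S)"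
    by (rule vector_space_cocycle_scale)
  show ?thesis
    using assms by (intro span_image_scale[of "{\<theta>}" "\<lambda>_. c", simplified])
qed

text \<open>
  The orbit is that of the line of \<open>\<gamma>\<close>, which contains this line itself because of the identity.
  Elements of the automorphism group are extensional, whence the restrictions to the carrier.
\<close>

lemma same_orbit_if_pullback_colinear:
  assumes \<gamma>: "\<gamma> \<in> cocycles (DGCA m C) (free_graded S)" "\<gamma> \<noteq> 0"
    and \<sigma>: "\<sigma> \<in> graded_iso (DGCA m C) (DGCA m C)"
    and b: "b \<noteq> 0" "pullback (DGCA m C) \<sigma> \<gamma> = cocycle_scale (free_graded S) b \<theta>"
  shows "\<exists>Orb \<in> grassmannian_orbits 1 (DGCA m C) (free_graded S).
    module.span (cocycle_scale (free_graded S)) {\<theta>} \<in> Orb \<and>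
    module.span (cocycle_scale (free_graded S)) {\<gamma>} \<in> Orb"
proof -
  let ?A = "DGCA m C" and ?V = "free_graded S :: ('a, nat \<Rightarrow> 'a) graded_space"
  let ?span = "module.span (cocycle_scale ?V)"
  define Orb where "Orb = orbit (Aut ?A) (\<lambda>\<sigma> W. pullback ?A \<sigma> ` W) (?span {\<gamma>})"
  have "Orb \<in> grassmannian_orbits 1 ?A ?V"
    unfolding Orb_def grassmannian_orbits_def orbits_def
    using span_in_grassmannian[OF \<gamma>] by blast
  moreover have in_Orb: "?span {pullback ?A \<tau> \<gamma>} \<in> Orb" if "\<tau> \<in> graded_iso ?A ?A" for \<tau>
  proof -
    have "pullback ?A (restrict \<tau> (carrier ?A)) ` ?span {\<gamma>} \<in> Orb"
      unfolding Orb_def orbit_def using restrict_in_Aut[OF that] by blast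
    moreover have "pullback ?A (restrict \<tau> (carrier ?A)) \<gamma> = pullback ?A \<tau> \<gamma>"
      by (rule pullback_cong) simp
    ultimately show ?thesis
      unfolding pullback_image_span by simp
  qed
  have "?span {\<theta>} \<in> Orb"
    using in_Orb[OF \<sigma>] unfolding b(2) span_cocycle_scale[OF b(1)] .
  moreover have "?span {\<gamma>} \<in> Orb"
  proof -
    have "id \<in> graded_iso ?A ?A"
      by (auto simp: graded_iso_def linear_on_def)
    from in_Orb[OF this] show ?thesis
      using pullback_ident[OF \<gamma>(1), of id] by simp
  qed
  ultimately show ?thesis
    by blast
qed

text \<open>
  If \<open>g\<close> and \<open>h\<close> carry one subspace \<open>W\<close> to the lines of \<open>\<theta>\<close> and \<open>\<gamma>\<close>, then \<open>h\<inverse> \<circ> g\<close> carries the line of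
  \<open>\<gamma>\<close> to that of \<open>\<theta>\<close>: pullback is contravariant, so first \<open>h\<inverse>\<close> returns to \<open>W\<close>.
\<close>

lemma pullback_colinear_if_same_orbit:
  assumes Orb: "Orb \<in> grassmannian_orbits k (DGCA m C) (free_graded S)"
      "module.span (cocycle_scale (free_graded S)) {\<theta>} \<in> Orb"
      "module.span (cocycle_scale (free_graded S)) {\<gamma>} \<in> Orb"
    and "\<theta> \<noteq> 0"
  shows "\<exists>\<sigma> \<in> graded_iso (DGCA m C) (DGCA m C). \<exists>b. b \<noteq> 0 \<and>
    pullback (DGCA m C) \<sigma> \<gamma> = cocycle_scale (free_graded S) b \<theta>"
proof -
  let ?A = "DGCA m C" and ?V = "free_graded S :: ('a, nat \<Rightarrow> 'a) graded_space"
  interpret vector_space "cocycle_scale ?V"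
    by (rule vector_space_cocycle_scale)
  obtain W g h where W: "W \<in> grassmannian k ?A ?V"
    and Aut: "g \<in> carrier (Aut ?A)" "h \<in> carrier (Aut ?A)"
    and lines: "span {\<theta>} = pullback ?A g ` W" "span {\<gamma>} = pullback ?A h ` W"
    using Orb unfolding grassmannian_orbits_def orbits_def orbit_def by auto
  from Aut have g: "g \<in> graded_iso ?A ?A" and h: "h \<in> graded_iso ?A ?A"
    by (auto simp: Aut_def)
  define h' where "h' = inv_into (carrier ?A) h"
  have h': "h' \<in> graded_iso ?A ?A"
    unfolding h'_def using h closed_DGCA
    by (rule graded_iso_inv_into) (use graded_iso_component_surj[OF h] in blast)
  have "\<theta> \<in> pullback ?A g ` W"
    unfolding lines(1)[symmetric] by (rule span_base) simp
  then obtain \<omega> where \<omega>: "\<omega> \<in> W" "\<theta> = pullback ?A g \<omega>"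
    by blast
  have "pullback ?A h \<omega> \<in> span {\<gamma>}"
    using \<omega>(1) lines(2) by blast
  then obtain c where c: "pullback ?A h \<omega> = cocycle_scale ?V c \<gamma>"
    unfolding span_cocycle by blast
  have "\<omega> = pullback ?A (h \<circ> h') \<omega>"
  proof (rule pullback_ident[symmetric])
    show "\<omega> \<in> cocycles ?A ?V"
      using W \<omega>(1) by (auto simp: grassmannian_def)
    show "(h \<circ> h') x = x" if "x \<in> carrier ?A" for x
      using bij_betw_inv_into_right[OF graded_isoD(1)[OF h] that] by (simp add: h'_def)
  qed
  also have "\<dots> = pullback ?A h' (pullback ?A h \<omega>)"
    by (rule pullback_pullback[symmetric]) (rule graded_isoD(2)[OF h'])
  finally have "\<theta> = pullback ?A g (pullback ?A h' (cocycle_scale ?V c \<gamma>))"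
    using \<omega>(2) c by simp
  also have "\<dots> = cocycle_scale ?V c (pullback ?A (h' \<circ> g) \<gamma>)"
    by (simp only: pullback_cocycle_scale pullback_pullback[OF graded_isoD(2)[OF g]])
  finally have \<theta>: "\<theta> = cocycle_scale ?V c (pullback ?A (h' \<circ> g) \<gamma>)" .
  with \<open>\<theta> \<noteq> 0\<close> have "c \<noteq> 0"
    by auto
  with \<theta> have "pullback ?A (h' \<circ> g) \<gamma> = cocycle_scale ?V (1 / c) \<theta>"
    by simp
  with \<open>c \<noteq> 0\<close> show ?thesis
    using graded_iso_comp[OF g h'] by (intro bexI[of _ "h' \<circ> g"] exI[of _ "1 / c"]) simp_all
qed

theorem theorem3p5:
  fixes C C' :: "nat \<Rightarrow> nat \<Rightarrow> 'k::alg_closed_field"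
    and V :: "('k, nat \<Rightarrow> 'k) graded_space"
    and n :: nat
  assumes "n \<ge> 2"
    and "C \<in> DGCA_matrices (n - 1)"
    and "C' \<in> DGCA_matrices (n - 1)"
    and "V = free_graded {n}"
  shows
    "(\<forall>\<gamma> \<in> cocycles (DGCA (n - 1) C) V. \<forall>\<theta> \<in> cocycles (DGCA (n - 1) C') V.
        graded_isomorphic (central_extension (DGCA (n - 1) C) V \<gamma>)
                          (central_extension (DGCA (n - 1) C') V \<theta>) \<longleftrightarrow>
        (\<exists>\<sigma> \<in> graded_iso (DGCA (n - 1) C) (DGCA (n - 1) C').
           \<exists>b. b \<noteq> 0 \<and> pullback (DGCA (n - 1) C) \<sigma> \<theta> = cocycle_scale V b \<gamma>)) \<and>
     (\<forall>\<theta> \<in> cocycles (DGCA (n - 1) C) V. \<forall>\<gamma> \<in> cocycles (DGCA (n - 1) C) V.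
        \<theta> \<noteq> 0 \<longrightarrow> \<gamma> \<noteq> 0 \<longrightarrow>
        (graded_isomorphic (central_extension (DGCA (n - 1) C) V \<theta>)
                           (central_extension (DGCA (n - 1) C) V \<gamma>) \<longleftrightarrow>
         (\<exists>Orb \<in> grassmannian_orbits 1 (DGCA (n - 1) C) V.
            module.span (cocycle_scale V) {\<theta>} \<in> Orb \<and>
            module.span (cocycle_scale V) {\<gamma>} \<in> Orb)))"
proof -
  have "n - 1 < n"
    using \<open>n \<ge> 2\<close> by simp
  note iff = graded_isomorphic_central_extension_iff[OF _ this]
  have "graded_isomorphic (central_extension (DGCA (n - 1) C) V \<theta>)
          (central_extension (DGCA (n - 1) C) V \<gamma>) \<longleftrightarrow>
        (\<exists>Orb \<in> grassmannian_orbits 1 (DGCA (n - 1) C) V.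
          module.span (cocycle_scale V) {\<theta>} \<in> Orb \<and>
          module.span (cocycle_scale V) {\<gamma>} \<in> Orb)"
    if "\<theta> \<in> cocycles (DGCA (n - 1) C) V" "\<gamma> \<in> cocycles (DGCA (n - 1) C) V" "\<theta> \<noteq> 0" "\<gamma> \<noteq> 0"
    for \<theta> \<gamma>
  proof -
    note coc = that(1,2)[unfolded \<open>V = free_graded {n}\<close>]
    show ?thesis
      unfolding \<open>V = free_graded {n}\<close> iff[OF coc(1)]
    proof
      assume "\<exists>\<sigma>\<in>graded_iso (DGCA (n - 1) C) (DGCA (n - 1) C). \<exists>b. b \<noteq> 0 \<and>
        pullback (DGCA (n - 1) C) \<sigma> \<gamma> = cocycle_scale (free_graded {n}) b \<theta>"
      then show "\<exists>Orb\<in>grassmannian_orbits 1 (DGCA (n - 1) C) (free_graded {n}).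
          module.span (cocycle_scale (free_graded {n})) {\<theta>} \<in> Orb \<and>
          module.span (cocycle_scale (free_graded {n})) {\<gamma>} \<in> Orb"
        by (elim bexE exE conjE) (rule same_orbit_if_pullback_colinear[OF coc(2) \<open>\<gamma> \<noteq> 0\<close>])
    next
      assume "\<exists>Orb\<in>grassmannian_orbits 1 (DGCA (n - 1) C) (free_graded {n}).
        module.span (cocycle_scale (free_graded {n})) {\<theta>} \<in> Orb \<and>
        module.span (cocycle_scale (free_graded {n})) {\<gamma>} \<in> Orb"
      then show "\<exists>\<sigma>\<in>graded_iso (DGCA (n - 1) C) (DGCA (n - 1) C). \<exists>b. b \<noteq> 0 \<and>
          pullback (DGCA (n - 1) C) \<sigma> \<gamma> = cocycle_scale (free_graded {n}) b \<theta>"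
        by (elim bexE conjE) (rule pullback_colinear_if_same_orbit[OF _ _ _ \<open>\<theta> \<noteq> 0\<close>])
    qed
  qed
  then show ?thesis
    unfolding \<open>V = free_graded {n}\<close> by (intro conjI ballI impI iff)
qed

end
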